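(* For each of the two asynchronous dynamics (the partially asynchronous dynamic with any update rate $0<\alpha\le 1$, and the fully asynchronous dynamic), the elementary cellular automaton with Wolfram code $60$ is not coalescing.
   Context: An elementary cellular automaton (ECA) has cell space $\mathcal{U}=\mathbb{Z}/n\mathbb{Z}$ (size $n$, periodic boundary), states $\{0,1\}$, and a rule $\delta:\{0,1\}^3\to\{0,1\}$ applied to (left neighbor, cell itself, right neighbor). Its Wolfram code is $2^7\delta(1,1,1)+2^6\delta(1,1,0)+2^5\delta(1,0,1)+2^4\delta(1,0,0)+2^3\delta(0,1,1)+2^2\delta(0,1,0)+2\,\delta(0,0,1)+\delta(0,0,0)$. (Rule $60$ is $\delta(q_1,q_2,q_3)=q_1+q_2 \bmod 2$.) Asynchronous evolution: let $(M_t)_{t\in\mathbb{N}}$ be i.i.d. random elements of $\{0,1\}^{\mathcal{U}}$. Given $c_0:\mathcal{U}\to\{0,1\}$, set $c_{t+1}(z)=c_t(z)$ if $M_t(z)=0$ and $c_{t+1}(z)=\delta(c_t(z-1),c_t(z),c_t(z+1))$ if $M_t(z)=1$. Partially asynchronous dynamic with rate $\alpha$: the coordinates of $M_t$ are independent Bernoulli($\alpha$). Fully asynchronous dynamic: $M_t$ has exactly one coordinate equal to $1$, at a uniformly random cell. Coalescing: run two copies of the CA from initial configurations $c_0,c_0'$ with the same update sequence $(M_t)$, and let $T$ be the first time $t$ with $c_t=c_t'$ ($T=\infty$ if there is none). The CA is coalescing (for a given dynamic) if there is a polynomial $P$ such that for all sufficiently large $n$ and any two initial configurations on size $n$, $\mathbb{E}[T]\le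 P(n)$. *)

theory Defs
  imports "HOL-Probability.Probability" "HOL-Computational_Algebra.Polynomial"
begin

text \<open>
  The cell space $Z/nZ$ is represented by the residues \<open>{0..<int n}\<close>, with neighbours taken
  modulo \<open>n\<close>; the states 0 and 1 are \<open>False\<close> and \<open>True\<close>. Configurations and update masks
  are total functions on \<open>int\<close> of which only the values on the cells are meaningful.
\<close>

definition cells :: "nat \<Rightarrow> int set" where
  "cells n = {0..<int n}"

type_synonym config = "int \<Rightarrow> bool"
type_synonym mask = "int \<Rightarrow> bool"
type_synonym local_rule = "bool \<Rightarrow> bool \<Rightarrow> bool \<Rightarrow> bool"

definition wolfram_code :: "local_rule \<Rightarrow> nat" where
  "wolfram_code \<delta> =
     2^7 * of_bool (\<delta> True True True) + 2^6 * of_bool (\<delta> True True False) +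
     2^5 * of_bool (\<delta> True False True) + 2^4 * of_bool (\<delta> True False False) +
     2^3 * of_bool (\<delta> False True True) + 2^2 * of_bool (\<delta> False True False) +
     2 * of_bool (\<delta> False False True) + of_bool (\<delta> False False False)"

lemma wolfram_code_60_iff:
  "wolfram_code \<delta> = 60 \<longleftrightarrow> \<delta> = (\<lambda>q1 q2 q3. q1 \<noteq> q2)"
proof
  assume "wolfram_code \<delta> = 60"
  then have "\<delta> q1 q2 q3 = (q1 \<noteq> q2)" for q1 q2 q3
    unfolding wolfram_code_def
    by (cases q1; cases q2; cases q3) (auto simp: of_bool_def split: if_splits)
  then show "\<delta> = (\<lambda>q1 q2 q3. q1 \<noteq> q2)" by blast
qed (simp add: wolfram_code_def)

definition eca_step :: "nat \<Rightarrow> local_rule \<Rightarrow> mask \<Rightarrow> config \<Rightarrow> config" where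
  "eca_step n \<delta> m c =
     (\<lambda>z. if m z then \<delta> (c ((z - 1) mod int n)) (c z) (c ((z + 1) mod int n)) else c z)"

primrec evolve :: "nat \<Rightarrow> local_rule \<Rightarrow> (nat \<Rightarrow> mask) \<Rightarrow> config \<Rightarrow> nat \<Rightarrow> config" where
  "evolve n \<delta> \<omega> c 0 = c"
| "evolve n \<delta> \<omega> c (Suc t) = eca_step n \<delta> (\<omega> t) (evolve n \<delta> \<omega> c t)"

definition coalesced_at ::
    "nat \<Rightarrow> local_rule \<Rightarrow> config \<Rightarrow> config \<Rightarrow> (nat \<Rightarrow> mask) \<Rightarrow> nat \<Rightarrow> bool" where
  "coalesced_at n \<delta> c c' \<omega> t \<longleftrightarrow>
     (\<forall>z\<in>cells n. evolve n \<delta> \<omega> c t z = evolve n \<delta> \<omega> c' t z)"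

definition coalescence_time ::
    "nat \<Rightarrow> local_rule \<Rightarrow> config \<Rightarrow> config \<Rightarrow> (nat \<Rightarrow> mask) \<Rightarrow> ennreal" where
  "coalescence_time n \<delta> c c' \<omega> =
     (if \<exists>t. coalesced_at n \<delta> c c' \<omega> t
      then of_nat (LEAST t. coalesced_at n \<delta> c c' \<omega> t) else \<infinity>)"

text \<open>
  A dynamic gives, for each size \<open>n\<close>, the law of a single update mask. The i.i.d. sequence of
  masks is the coordinate process on the infinite product space.
\<close>

type_synonym dynamic = "nat \<Rightarrow> mask pmf"

definition partially_async :: "real \<Rightarrow> dynamic" where
  "partially_async \<alpha> n = Pi_pmf (cells n) False (\<lambda>_. bernoulli_pmf \<alpha>)"

definition fully_async :: dynamic where
  "fully_async n = map_pmf (\<lambda>u z. z = u) (pmf_of_set (cells n))"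

definition update_space :: "dynamic \<Rightarrow> nat \<Rightarrow> (nat \<Rightarrow> mask) measure" where
  "update_space D n = (\<Pi>\<^sub>M t\<in>(UNIV :: nat set). measure_pmf (D n))"

definition expected_coalescence_time ::
    "dynamic \<Rightarrow> local_rule \<Rightarrow> nat \<Rightarrow> config \<Rightarrow> config \<Rightarrow> ennreal" where
  "expected_coalescence_time D \<delta> n c c' =
     (\<integral>\<^sup>+ \<omega>. coalescence_time n \<delta> c c' \<omega> \<partial>update_space D n)"

text \<open>
  The comparison takes place in \<open>ereal\<close>, since \<open>ennreal\<close> would truncate negative values of the
  polynomial to 0.
\<close>

definition coalescing :: "dynamic \<Rightarrow> local_rule \<Rightarrow> bool" where
  "coalescing D \<delta> \<longleftrightarrow>
     (\<exists>P :: real poly. \<forall>\<^sub>F n in sequentially. \<forall>c c'.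
        enn2ereal (expected_coalescence_time D \<delta> n c c') \<le> ereal (poly P (real n)))"

end

theory Submission
  imports Defs "HOL-Real_Asymp.Real_Asymp"
begin

text \<open>
  Compare the orbit of the configuration with a single 1 with the zero configuration, which
  rule 60 fixes. If a nonzero configuration becomes zero in one step, then every cell in state 1
  was updated and had its left neighbour in state 1; following the neighbours around the cycle,
  the configuration was all ones and every cell was updated. In the fully asynchronous dynamic
  this is impossible, and for rate \<open>\<alpha> < 1\<close> it requires a mask of probability \<open>\<alpha>\<close> to the power
  \<open>n\<close>, so that the expected coalescence time is superpolynomial. For rate 1 and odd \<open>n\<close> the
  all-ones configuration has no predecessor, since its predecessor would alternate around an odd
  cycle.
\<close>

section \<open>Orbits of rule 60 against the zero configuration\<close>

definition rule60 :: local_rule where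
  "rule60 q1 q2 q3 \<longleftrightarrow> q1 \<noteq> q2"

definition full_masks :: "nat \<Rightarrow> mask set" where
  "full_masks n = {m. \<forall>z\<in>cells n. m z}"

lemma evolve_rule60_zero: "evolve n rule60 \<omega> (\<lambda>_. False) t = (\<lambda>_. False)"
  by (induction t) (auto simp: eca_step_def rule60_def)

lemma coalesced_at_rule60_zero:
  "coalesced_at n rule60 c (\<lambda>_. False) \<omega> t \<longleftrightarrow> (\<forall>z\<in>cells n. \<not> evolve n rule60 \<omega> c t z)"
  by (simp add: coalesced_at_def evolve_rule60_zero)

lemma rule60_step_to_zero:
  assumes zero: "\<forall>z\<in>cells n. \<not> eca_step n rule60 m c z"
    and z: "z \<in> cells n" "c z"
  shows "m \<in> full_masks n" and "\<forall>y\<in>cells n. c y"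
proof -
  have n: "int n > 0" using z by (auto simp: cells_def)
  \<comment> \<open>A cell in state 1 keeps its 1 if it is not updated, and also if it is updated
    with left neighbour 0.\<close>
  have left: "m y \<and> c ((y - 1) mod int n)" if "y \<in> cells n" "c y" for y
    using zero that by (auto simp: eca_step_def rule60_def split: if_splits)
  have shift: "c ((z - int k) mod int n)" for k
  proof (induction k)
    case 0
    then show ?case using z by (simp add: cells_def)
  next
    case (Suc k)
    have "c (((z - int k) mod int n - 1) mod int n)"
      using left[OF _ Suc] n by (simp add: cells_def)
    then show ?case by (simp add: mod_simps algebra_simps)
  qed
  show ones: "\<forall>y\<in>cells n. c y"
  proof
    fix y assume y: "y \<in> cells n"
    \<comment> \<open>Walking left from \<open>z\<close>, the cell \<open>y\<close> is reached after
      \<open>(z - y) mod n\<close> steps.\<close>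
    have "(z - int (nat ((z - y) mod int n))) mod int n = y"
      using n y by (simp add: mod_simps cells_def)
    then show "c y" using shift by metis
  qed
  then show "m \<in> full_masks n" using left by (auto simp: full_masks_def)
qed

lemma rule60_full_step_not_ones:
  assumes "odd n" and m: "m \<in> full_masks n"
  shows "\<exists>z\<in>cells n. \<not> eca_step n rule60 m c z"
proof (rule ccontr)
  assume "\<not> ?thesis"
  then have alt: "c ((z - 1) mod int n) \<noteq> c z" if "z \<in> cells n" for z
    using m that by (auto simp: eca_step_def rule60_def full_masks_def)
  have parity: "k < n \<Longrightarrow> c (int k) \<longleftrightarrow> (c 0 \<longleftrightarrow> even k)" for k
  proof (induction k)
    case (Suc k)
    then show ?case using alt[of "int (Suc k)"] by (auto simp: cells_def)
  qed simp
  have n: "n > 0" using \<open>odd n\<close> by (rule odd_pos)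
  \<comment> \<open>The cycle closes at cell 0, whose left neighbour is \<open>n - 1\<close>. This
    number is even, so \<open>parity\<close> gives the two cells equal states, while
    \<open>alt\<close> makes them differ.\<close>
  have "(- 1) mod int n = int (n - 1)"
    using n by (simp add: zmod_minus1 of_nat_diff)
  then have "c (int (n - 1)) \<noteq> c 0"
    using alt[of 0] n by (simp add: cells_def)
  then show False using parity[of "n - 1"] n \<open>odd n\<close> by simp
qed

text \<open>By induction the orbit stays nonzero: it starts with a 1 at cell 0, and only a full mask
  can erase the last 1s.\<close>

lemma rule60_not_coalesced_nonfull:
  assumes "n > 0" and "\<forall>s<t. \<omega> s \<in> - full_masks n"
  shows "\<not> coalesced_at n rule60 (\<lambda>z. z = 0) (\<lambda>_. False) \<omega> t"
  using assms(2)
proof (induction t)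
  case 0
  then show ?case using \<open>n > 0\<close> by (auto simp: coalesced_at_rule60_zero cells_def)
next
  case (Suc t)
  then show ?case
    using rule60_step_to_zero(1) by (fastforce simp: coalesced_at_rule60_zero)
qed

text \<open>Being nonzero is not an invariant by itself here, since a full mask sends all ones to
  zero. The induction therefore carries both a 1 and a 0: the 0 preserves nonzeroness, and odd
  \<open>n\<close> keeps the all-ones configuration out of reach. The initial 0 sits at cell 1,
  whence \<open>n > 1\<close>.\<close>

lemma rule60_not_coalesced_full:
  assumes "odd n" "n > 1" and "\<forall>s<t. \<omega> s \<in> full_masks n"
  shows "\<not> coalesced_at n rule60 (\<lambda>z. z = 0) (\<lambda>_. False) \<omega> t"
proof -
  let ?c = "evolve n rule60 \<omega> (\<lambda>z. z = 0)"
  have "(\<exists>z\<in>cells n. ?c t z) \<and> (\<exists>z\<in>cells n. \<not> ?c t z)"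
    using assms(3)
  proof (induction t)
    case 0
    have "0 \<in> cells n" "1 \<in> cells n" using \<open>n > 1\<close> by (auto simp: cells_def)
    then show ?case by (auto intro: bexI[of _ 1])
  next
    case (Suc t)
    then obtain y z where y: "y \<in> cells n" "?c t y" and z: "z \<in> cells n" "\<not> ?c t z"
      by auto
    have "\<exists>z\<in>cells n. ?c (Suc t) z"
      using rule60_step_to_zero(2)[where c = "?c t", OF _ y] z by auto
    moreover have "\<exists>z\<in>cells n. \<not> ?c (Suc t) z"
      using rule60_full_step_not_ones[OF \<open>odd n\<close>] Suc.prems by simp
    ultimately show ?case by blast
  qed
  then show ?thesis by (auto simp: coalesced_at_rule60_zero)
qed

section \<open>From rare bad masks to superpolynomial expected time\<close>

text \<open>A union bound: with probability at least 1/2 none of the first \<open>k\<close> masks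
  leaves \<open>S\<close>. On that event the coalescence time is at least \<open>k\<close>, which
  contributes \<open>k / 2\<close> to the expectation.\<close>

lemma expected_coalescence_time_ge:
  assumes no: "\<And>\<omega> t. \<forall>s<t. \<omega> s \<in> S \<Longrightarrow> \<not> coalesced_at n \<delta> c c' \<omega> t"
    and k: "real k * measure_pmf.prob (D n) (- S) \<le> 1/2"
  shows "expected_coalescence_time D \<delta> n c c' \<ge> ennreal (real k / 2)"
proof -
  interpret product_prob_space "\<lambda>_. measure_pmf (D n)" "UNIV :: nat set"
    by unfold_locales
  let ?M = "update_space D n"
  have M: "?M = (\<Pi>\<^sub>M t\<in>UNIV. measure_pmf (D n))"
    by (simp add: update_space_def)
  interpret M: prob_space ?M
    unfolding M by (rule prob_space_PiM) (rule measure_pmf.prob_space_axioms)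
  define B where "B t = {\<omega> \<in> space ?M. \<omega> t \<in> - S}" for t
  have B_sets: "B t \<in> sets ?M" for t
    unfolding B_def M by (rule measurable_sets_Collect[OF measurable_component_singleton]) auto
  have B_prob: "M.prob (B t) = measure_pmf.prob (D n) (- S)" for t
  proof -
    have "emeasure (\<Pi>\<^sub>M t\<in>UNIV. measure_pmf (D n))
        {\<omega> \<in> space (\<Pi>\<^sub>M t\<in>UNIV. measure_pmf (D n)). \<forall>i\<in>{t}. \<omega> i \<in> - S}
        = (\<Prod>i\<in>{t}. emeasure (measure_pmf (D n)) (- S))"
      by (rule emeasure_PiM_Collect) auto
    then show ?thesis unfolding B_def M measure_def by simp
  qed
  define A where "A = space ?M - (\<Union>t<k. B t)"
  have A_sets: "A \<in> sets ?M" unfolding A_def using B_sets by auto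
  have "M.prob (\<Union>t<k. B t) \<le> (\<Sum>t<k. M.prob (B t))"
    using B_sets by (intro M.finite_measure_subadditive_finite) auto
  also have "\<dots> \<le> 1/2" using k by (simp add: B_prob)
  finally have A_prob: "M.prob A \<ge> 1/2"
    unfolding A_def using B_sets by (subst M.prob_compl) auto
  have time: "coalescence_time n \<delta> c c' \<omega> \<ge> of_nat k" if "\<omega> \<in> A" for \<omega>
  proof (cases "\<exists>t. coalesced_at n \<delta> c c' \<omega> t")
    case True
    then have "coalesced_at n \<delta> c c' \<omega> (LEAST t. coalesced_at n \<delta> c c' \<omega> t)"
      by (rule LeastI_ex)
    moreover have "\<not> coalesced_at n \<delta> c c' \<omega> t" if "t < k" for t
      using \<open>\<omega> \<in> A\<close> that by (intro no) (auto simp: A_def B_def)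
    ultimately have "k \<le> (LEAST t. coalesced_at n \<delta> c c' \<omega> t)"
      by (meson not_less)
    then show ?thesis using True by (simp add: coalescence_time_def)
  qed (simp add: coalescence_time_def)
  have "ennreal (real k / 2) \<le> ennreal (real k * M.prob A)"
    using A_prob mult_left_mono[OF A_prob, of "real k"] by (intro ennreal_leI) simp
  also have "\<dots> = of_nat k * emeasure ?M A"
    by (simp add: M.emeasure_eq_measure ennreal_mult ennreal_of_nat_eq_real_of_nat)
  also have "\<dots> = (\<integral>\<^sup>+ \<omega>. of_nat k * indicator A \<omega> \<partial>?M)"
    using A_sets by (simp add: nn_integral_cmult_indicator)
  also have "\<dots> \<le> expected_coalescence_time D \<delta> n c c'"
    unfolding expected_coalescence_time_def
    using time by (intro nn_integral_mono) (auto simp: indicator_def)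
  finally show ?thesis .
qed

lemma poly_le_power_degree:
  fixes P :: "real poly"
  assumes "x \<ge> 1"
  shows "poly P x \<le> (\<Sum>i\<le>degree P. \<bar>coeff P i\<bar>) * x ^ degree P"
  unfolding poly_altdef sum_distrib_right
proof (rule sum_mono)
  fix i assume "i \<in> {..degree P}"
  then have "x ^ i \<le> x ^ degree P" using assms by (intro power_increasing) auto
  then show "coeff P i * x ^ i \<le> \<bar>coeff P i\<bar> * x ^ degree P"
    using assms by (intro mult_mono) auto
qed

text \<open>Applies the lower bound with \<open>k = n ^ j\<close>, for every exponent
  \<open>j\<close>. Infinitely many sizes suffice to refute a bound that holds for all large
  \<open>n\<close>; this matters for rate 1, where only odd sizes are used.\<close>

lemma not_coalescingI:
  assumes "\<And>j. \<exists>\<^sub>F n in sequentially. \<exists>c c' S.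
      (\<forall>\<omega> t. (\<forall>s<t. \<omega> s \<in> S) \<longrightarrow> \<not> coalesced_at n \<delta> c c' \<omega> t) \<and>
      real (n ^ j) * measure_pmf.prob (D n) (- S) \<le> 1/2"
  shows "\<not> coalescing D \<delta>"
proof
  assume "coalescing D \<delta>"
  then obtain P :: "real poly" where P: "\<forall>\<^sub>F n in sequentially. \<forall>c c'.
      enn2ereal (expected_coalescence_time D \<delta> n c c') \<le> ereal (poly P (real n))"
    by (auto simp: coalescing_def)
  define C where "C = (\<Sum>i\<le>degree P. \<bar>coeff P i\<bar>)"
  \<comment> \<open>With \<open>j\<close> one above the degree \<open>d\<close> of \<open>P\<close>,
    the lower bound is \<open>n * n ^ d / 2\<close>, which exceeds \<open>C * n ^ d\<close> once
    \<open>n > 2 * C\<close>.\<close>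
  have large: "\<forall>\<^sub>F n in sequentially. 2 * C < real n \<and> 1 \<le> real n"
    using eventually_gt_at_top[of "nat \<lceil>2 * C\<rceil>"] eventually_ge_at_top[of 1]
    by eventually_elim linarith
  have "\<exists>\<^sub>F n in sequentially. False"
  proof (rule frequently_rev_mp[OF assms[of "Suc (degree P)"]], use P large in eventually_elim, safe)
    fix n c c' S
    assume bound: "\<forall>c c'. enn2ereal (expected_coalescence_time D \<delta> n c c') \<le> ereal (poly P (real n))"
      and n: "2 * C < real n" "1 \<le> real n"
      and no: "\<forall>\<omega> t. (\<forall>s<t. \<omega> s \<in> S) \<longrightarrow> \<not> coalesced_at n \<delta> c c' \<omega> t"
      and prob: "real (n ^ Suc (degree P)) * measure_pmf.prob (D n) (- S) \<le> 1/2"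
    have "ennreal (real (n ^ Suc (degree P)) / 2) \<le> expected_coalescence_time D \<delta> n c c'"
      using no prob by (intro expected_coalescence_time_ge[where S = S]) blast+
    then have "ereal (real (n ^ Suc (degree P)) / 2) \<le> enn2ereal (expected_coalescence_time D \<delta> n c c')"
      by (simp add: less_eq_ennreal.rep_eq)
    also have "\<dots> \<le> ereal (poly P (real n))" using bound by blast
    finally have "real n * real n ^ degree P \<le> 2 * poly P (real n)" by simp
    also have "\<dots> \<le> (2 * C) * real n ^ degree P"
      using poly_le_power_degree[OF n(2), of P] by (simp add: C_def)
    also have "\<dots> < real n * real n ^ degree P"
      using n by (intro mult_strict_right_mono) auto
    finally show False by simp
  qed
  then show False by simp
qed

section \<open>Full masks under the two dynamics, and the conclusion\<close>

lemma prob_full_masks_partially_async: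
  assumes "0 \<le> \<alpha>" "\<alpha> \<le> 1"
  shows "measure_pmf.prob (partially_async \<alpha> n) (full_masks n) = \<alpha> ^ n"
proof -
  have "full_masks n = Pi (cells n) (\<lambda>_. {True})"
    by (auto simp: full_masks_def)
  then show ?thesis
    using assms
    by (simp add: partially_async_def measure_Pi_pmf_Pi cells_def measure_pmf_single)
qed

lemma prob_full_masks_fully_async:
  assumes "n > 1"
  shows "measure_pmf.prob (fully_async n) (full_masks n) = 0"
proof -
  have "(\<lambda>z. z = u) \<notin> full_masks n" for u
  proof
    assume "(\<lambda>z. z = u) \<in> full_masks n"
    then have "z = u" if "z \<in> cells n" for z using that by (simp add: full_masks_def)
    \<comment> \<open>A single updated cell cannot be both 0 and 1, which are distinct cells as
      \<open>n > 1\<close>.\<close>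
    from this[of 0] this[of 1] show False using assms by (simp add: cells_def)
  qed
  then have "(\<lambda>u z. z = u) -` full_masks n = {}" by auto
  then show ?thesis by (simp add: fully_async_def)
qed

theorem mainTheorem2:
  fixes \<delta> :: local_rule
  assumes "wolfram_code \<delta> = 60"
  shows "(\<forall>\<alpha>::real. 0 < \<alpha> \<and> \<alpha> \<le> 1 \<longrightarrow> \<not> coalescing (partially_async \<alpha>) \<delta>)
    \<and> \<not> coalescing fully_async \<delta>"
proof -
  have \<delta>: "\<delta> = rule60" using assms by (simp add: wolfram_code_60_iff rule60_def fun_eq_iff)
  \<comment> \<open>Serves both rates below 1 and the fully asynchronous dynamic: the good masks are
    the non-full ones.\<close>
  have nonfull: "\<not> coalescing D rule60"
    if "\<And>j. \<forall>\<^sub>F n in sequentially. real (n ^ j) * measure_pmf.prob (D n) (full_masks n) \<le> 1/2" for D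
  proof (rule not_coalescingI, rule eventually_frequently)
    fix j
    show "\<forall>\<^sub>F n in sequentially. \<exists>c c' S.
        (\<forall>\<omega> t. (\<forall>s<t. \<omega> s \<in> S) \<longrightarrow> \<not> coalesced_at n rule60 c c' \<omega> t) \<and>
        real (n ^ j) * measure_pmf.prob (D n) (- S) \<le> 1/2"
      using that[of j] eventually_gt_at_top[of 0]
    proof eventually_elim
      case (elim n)
      then show ?case
        using rule60_not_coalesced_nonfull[of n]
        by (intro exI[of _ "\<lambda>z. z = 0"] exI[of _ "\<lambda>_. False"] exI[of _ "- full_masks n"]) auto
    qed
  qed simp
  have "\<not> coalescing (partially_async \<alpha>) rule60" if "0 < \<alpha>" "\<alpha> < 1" for \<alpha>
  proof (rule nonfull)
    fix j
    have "(\<lambda>n. real n ^ j * \<alpha> ^ n) \<longlonglongrightarrow> 0"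
      using that by real_asymp
    then have "\<forall>\<^sub>F n in sequentially. real n ^ j * \<alpha> ^ n < 1/2"
      by (rule order_tendstoD) simp
    then show "\<forall>\<^sub>F n in sequentially.
        real (n ^ j) * measure_pmf.prob (partially_async \<alpha> n) (full_masks n) \<le> 1/2"
      by eventually_elim (use that in \<open>simp add: prob_full_masks_partially_async\<close>)
  qed
  \<comment> \<open>At rate 1 the roles are exchanged: masks are almost surely full, so the good set
    is \<open>full_masks n\<close>.\<close>
  moreover have "\<not> coalescing (partially_async 1) rule60"
  proof (rule not_coalescingI)
    fix j
    show "\<exists>\<^sub>F n in sequentially. \<exists>c c' S.
        (\<forall>\<omega> t. (\<forall>s<t. \<omega> s \<in> S) \<longrightarrow> \<not> coalesced_at n rule60 c c' \<omega> t) \<and>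
        real (n ^ j) * measure_pmf.prob (partially_async 1 n) (- S) \<le> 1/2"
      unfolding frequently_sequentially
    proof
      fix N :: nat
      \<comment> \<open>An odd size above 1 and beyond the given threshold \<open>N\<close>.\<close>
      define n where "n = 2 * N + 3"
      have n: "odd n" "n > 1" "n \<ge> N" by (auto simp: n_def)
      have "measure_pmf.prob (partially_async 1 n) (- full_masks n) = 0"
        using prob_full_masks_partially_async[of 1 n]
          measure_pmf.prob_compl[of "full_masks n" "partially_async 1 n"]
        by (simp add: Compl_eq_Diff_UNIV)
      then show "\<exists>n\<ge>N. \<exists>c c' S.
          (\<forall>\<omega> t. (\<forall>s<t. \<omega> s \<in> S) \<longrightarrow> \<not> coalesced_at n rule60 c c' \<omega> t) \<and>
          real (n ^ j) * measure_pmf.prob (partially_async 1 n) (- S) \<le> 1/2"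
        using n rule60_not_coalesced_full[of n]
        by (intro exI[of _ n] conjI exI[of _ "\<lambda>z. z = 0"] exI[of _ "\<lambda>_. False"]
            exI[of _ "full_masks n"]) auto
    qed
  qed
  moreover have "\<not> coalescing fully_async rule60"
  proof (rule nonfull)
    fix j
    show "\<forall>\<^sub>F n in sequentially.
        real (n ^ j) * measure_pmf.prob (fully_async n) (full_masks n) \<le> 1/2"
      using eventually_gt_at_top[of 1]
      by eventually_elim (simp add: prob_full_masks_fully_async)
  qed
  ultimately show ?thesis unfolding \<delta> by (metis less_eq_real_def)
qed

end
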